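(* Let $\Omega\subset\mathbb R^d$ be a regular set with $\mu_d(\Omega)>0$ that is connected and contained in the closure of its interior, and let $f:\Omega\to\mathbb R$ be continuous a.e. on $\Omega$. Let $[\boldsymbol a,\boldsymbol b]$ be any $d$-dimensional rectangle containing $\Omega$ and let $\mathcal G_{\boldsymbol n}=\{\boldsymbol x_{\boldsymbol i,\boldsymbol n}\}_{\boldsymbol i=\mathbf 1,\ldots,\boldsymbol n}$ ($\boldsymbol n\in\mathbb N^d$) be any asymptotically uniform grid in $[\boldsymbol a,\boldsymbol b]$. For each $\boldsymbol n\in\mathbb N^d$, sort the samples $f(\boldsymbol x_{\boldsymbol i,\boldsymbol n})$, $\boldsymbol i\in\mathcal I_{\boldsymbol n}(\Omega)=\{\boldsymbol i\in\{\mathbf 1,\ldots,\boldsymbol n\}:\boldsymbol x_{\boldsymbol i,\boldsymbol n}\in\Omega\}$, (with multiplicity) in non-decreasing order into a vector $(s_0,\ldots,s_{\omega(\boldsymbol n)})$, where $\omega(\boldsymbol n)=\#\mathcal I_{\boldsymbol n}(\Omega)-1$, and let $f^\dag_{\boldsymbol n}:[0,1]\to\mathbb R$ be the linear spline function that interpolates $(s_0,\ldots,s_{\omega(\boldsymbol n)})$ over the equally spaced nodes $(0,\frac1{\omega(\boldsymbol n)},\frac2{\omega(\boldsymbol n)},\ldots,1)$. Then the following properties hold (all limits as $\boldsymbol n\to\infty$). 1. If $f$ is continuous on $\Omega$, then $f^\dag_{\boldsymbol n}\to f^\dag$ uniformly on every compact interval $[\alpha,\beta]\subset(0,1)$. 2.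 If $f$ is continuous and bounded from below on $\Omega$, then $f^\dag_{\boldsymbol n}\to f^\dag$ uniformly on every compact interval $[0,\alpha]\subset[0,1)$. 3. If $f$ is continuous and bounded from above on $\Omega$, then $f^\dag_{\boldsymbol n}\to f^\dag$ uniformly on every compact interval $[\alpha,1]\subset(0,1]$. 4. If $f$ is continuous and bounded on $\Omega$, then $f^\dag_{\boldsymbol n}\to f^\dag$ uniformly on $[0,1]$.
   Context: $\mu_d$ is Lebesgue measure in $\mathbb R^d$; all measure-theoretic terms refer to it. $\mathbb N=\{1,2,\ldots\}$. Regular set: $\Omega\subset\mathbb R^d$ is regular if it is bounded and $\mu_d(\partial\Omega)=0$. Monotone rearrangement: for $f:\Omega\to\mathbb R$ measurable with $0<\mu_d(\Omega)<\infty$, $f^\dag:(0,1)\to\mathbb R$ is $f^\dag(y)=\inf\{u\in\mathbb R:\mu_d\{\boldsymbol x\in\Omega:f(\boldsymbol x)\le u\}/\mu_d(\Omega)\ge y\}$; it is non-decreasing. If $f$ is bounded from below, $f^\dag$ is extended to $y=0$ by $f^\dag(0)=\lim_{y\to0}f^\dag(y)\in\mathbb R$; if $f$ is bounded from above, $f^\dag$ is extended to $y=1$ by $f^\dag(1)=\lim_{y\to1}f^\dag(y)\in\mathbb R$. Multi-indices: inequalities and operations (product, quotient) between vectors are componentwise; $\mathbf 1=(1,\ldots,1)$; $\{\mathbf 1,\ldots,\boldsymbol n\}=\{\boldsymbol i\in\mathbb Z^d:\mathbf 1\le\boldsymbol i\le\boldsymbol n\}$; $\boldsymbol n\to\infty$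 means $\min_j n_j\to\infty$. Rectangles: for $\boldsymbol a\le\boldsymbol b$ in $\mathbb R^d$, $[\boldsymbol a,\boldsymbol b]=[a_1,b_1]\times\cdots\times[a_d,b_d]$. Asymptotically uniform grid: a family, indexed by $\boldsymbol n\in\mathbb N^d$, of grids $\mathcal G_{\boldsymbol n}=\{\boldsymbol x_{\boldsymbol i,\boldsymbol n}\}_{\boldsymbol i=\mathbf 1,\ldots,\boldsymbol n}$ of points in $\mathbb R^d$ is asymptotically uniform in $[\boldsymbol a,\boldsymbol b]$ if \[ \lim_{\boldsymbol n\to\infty}\max_{\boldsymbol i=\mathbf 1,\ldots,\boldsymbol n}\Bigl\|\boldsymbol x_{\boldsymbol i,\boldsymbol n}-\Bigl(\boldsymbol a+\boldsymbol i\,\frac{\boldsymbol b-\boldsymbol a}{\boldsymbol n}\Bigr)\Bigr\|_\infty=0. \] Linear spline: $f^\dag_{\boldsymbol n}(i/\omega(\boldsymbol n))=s_i$ for $i=0,\ldots,\omega(\boldsymbol n)$ and $f^\dag_{\boldsymbol n}$ is affine on each $[\frac i{\omega(\boldsymbol n)},\frac{i+1}{\omega(\boldsymbol n)}]$. It is defined when $\omega(\boldsymbol n)\ge1$, which holds whenever $\min_j n_j$ is sufficiently large; $f^\dag_{\boldsymbol n}$ may be taken arbitrary for the other $\boldsymbol n$. *)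

theory Defs
  imports "HOL-Analysis.Analysis"
begin

definition regular_set :: "(real ^ 'd) set \<Rightarrow> bool" where
  "regular_set \<Omega> \<longleftrightarrow> bounded \<Omega> \<and> frontier \<Omega> \<in> null_sets lebesgue"

definition continuous_ae_on :: "(real ^ 'd) set \<Rightarrow> (real ^ 'd \<Rightarrow> real) \<Rightarrow> bool" where
  "continuous_ae_on \<Omega> f \<longleftrightarrow>
     (AE x in lebesgue. x \<in> \<Omega> \<longrightarrow> continuous (at x within \<Omega>) f)"

definition rearr_open :: "(real ^ 'd) set \<Rightarrow> (real ^ 'd \<Rightarrow> real) \<Rightarrow> real \<Rightarrow> real" where
  "rearr_open \<Omega> f y =
     Inf {u. measure lebesgue {x \<in> \<Omega>. f x \<le> u} / measure lebesgue \<Omega> \<ge> y}"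

text \<open>The values at 0 and 1 are meaningful only if the function is bounded from below, respectively
  from above, on the domain; otherwise the limit need not exist and \<^const>\<open>Lim\<close> is
  unspecified.\<close>

definition monotone_rearrangement ::
  "(real ^ 'd) set \<Rightarrow> (real ^ 'd \<Rightarrow> real) \<Rightarrow> real \<Rightarrow> real" where
  "monotone_rearrangement \<Omega> f y =
     (if y = 0 then Lim (at_right 0) (rearr_open \<Omega> f)
      else if y = 1 then Lim (at_left 1) (rearr_open \<Omega> f)
      else rearr_open \<Omega> f y)"

text \<open>Multi-indices are vectors of type \<^typ>\<open>nat ^ 'd\<close> with the componentwise order, so that
  \<open>{1..n}\<close> is the set of multi-indices between the all-ones vector and \<open>n\<close>. Vectors \<open>n\<close> with a zero
  component are irrelevant along the following filter, which expresses that the minimal component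
  tends to infinity.\<close>

definition multi_at_top :: "(nat ^ 'd) filter" where
  "multi_at_top = filtercomap (\<lambda>n. Min (range (\<lambda>j. n $ j))) at_top"

text \<open>A family of grids is a function \<open>x\<close>, where \<open>x n i\<close> is the point with index \<open>i\<close> of the grid
  with index \<open>n\<close>; only its values for \<open>i \<in> {1..n}\<close> are used.\<close>

definition asymptotically_uniform_grid ::
  "real ^ 'd \<Rightarrow> real ^ 'd \<Rightarrow> (nat ^ 'd \<Rightarrow> nat ^ 'd \<Rightarrow> real ^ 'd) \<Rightarrow> bool" where
  "asymptotically_uniform_grid a b x \<longleftrightarrow>
     ((\<lambda>n. Max ((\<lambda>i. infnorm (x n i -
          (\<chi> j. a $ j + real (i $ j) * ((b $ j - a $ j) / real (n $ j))))) ` {1..n}))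
       \<longlongrightarrow> 0) multi_at_top"

definition grid_indices ::
  "(real ^ 'd) set \<Rightarrow> (nat ^ 'd \<Rightarrow> nat ^ 'd \<Rightarrow> real ^ 'd) \<Rightarrow> nat ^ 'd \<Rightarrow> (nat ^ 'd) set" where
  "grid_indices \<Omega> x n = {i \<in> {1..n}. x n i \<in> \<Omega>}"

definition sorted_samples ::
  "(real ^ 'd) set \<Rightarrow> (real ^ 'd \<Rightarrow> real) \<Rightarrow> (nat ^ 'd \<Rightarrow> nat ^ 'd \<Rightarrow> real ^ 'd) \<Rightarrow> nat ^ 'd \<Rightarrow> real list"
  where
  "sorted_samples \<Omega> f x n =
     sorted_list_of_multiset (image_mset (\<lambda>i. f (x n i)) (mset_set (grid_indices \<Omega> x n)))"

text \<open>Truncated subtraction gives 0 instead of -1 if no grid point lies in the domain; the spline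
  is constrained only if the value is at least 1.\<close>

definition omega ::
  "(real ^ 'd) set \<Rightarrow> (nat ^ 'd \<Rightarrow> nat ^ 'd \<Rightarrow> real ^ 'd) \<Rightarrow> nat ^ 'd \<Rightarrow> nat" where
  "omega \<Omega> x n = card (grid_indices \<Omega> x n) - 1"

definition is_linear_spline :: "nat \<Rightarrow> real list \<Rightarrow> (real \<Rightarrow> real) \<Rightarrow> bool" where
  "is_linear_spline m s g \<longleftrightarrow>
     (\<forall>i\<le>m. g (real i / real m) = s ! i) \<and>
     (\<forall>i<m. \<exists>p q. \<forall>y\<in>{real i / real m..real (i + 1) / real m}. g y = p * y + q)"

end

theory Submission
  imports Defs "HOL-Probability.Weak_Convergence"
begin

text \<open>
  The rearrangement of \<open>f\<close> is the quantile function of the law of \<open>f\<close> under the normalised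
  Lebesgue measure on \<open>\<Omega>\<close>, and the splines interpolate the quantiles of the empirical
  distributions of the samples. If \<open>K\<close> is a compact part of an open set \<open>V\<close>, then for a fine grid
  every cell meeting \<open>K\<close> has its grid point in \<open>V\<close>, so the share of grid points in \<open>V\<close> is
  asymptotically at least the share of the volume; passing to complements gives convergence for
  sets with null boundary. Hence the proportions of samples below and above a level \<open>c\<close> are
  asymptotically at least the probabilities of \<open>f < c\<close> and \<open>f > c\<close>. This squeezes the splines
  around the quantiles, provided that \<open>f < c\<close> has probability greater than \<open>y\<close> for every \<open>c\<close>
  above the \<open>y\<close>-quantile, which holds because the range of \<open>f\<close> is connected and every open set
  meeting it has positive probability. The same fact makes the quantile function continuous, and
  pointwise convergence of monotone functions to a continuous limit on a compact interval is
  uniform.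
\<close>

section \<open>Monotone functions and linear splines\<close>

definition equipartition :: "real \<Rightarrow> real \<Rightarrow> nat \<Rightarrow> nat \<Rightarrow> real" where
  "equipartition u v m k = u + real k * ((v - u) / real m)"

lemma equipartition_0 [simp]: "equipartition u v m 0 = u"
  by (simp add: equipartition_def)

lemma equipartition_end [simp]: "0 < m \<Longrightarrow> equipartition u v m m = v"
  by (simp add: equipartition_def)

lemma equipartition_Suc_diff:
  "equipartition u v m (Suc k) - equipartition u v m k = (v - u) / real m"
  by (simp add: equipartition_def distrib_right del: times_divide_eq_right)

lemma equipartition_mono: "u \<le> v \<Longrightarrow> mono (equipartition u v m)"
  unfolding equipartition_def by (intro monoI add_left_mono mult_right_mono) auto

lemma equipartition_mem_Icc:
  assumes "u \<le> v" and "0 < m" and "k \<le> m"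
  shows "equipartition u v m k \<in> {u..v}"
  using monoD[OF equipartition_mono[OF assms(1)], of 0 k m]
    monoD[OF equipartition_mono[OF assms(1)], of k m m] assms by simp

lemma equipartition_cell_exists:
  assumes "0 < m" and "t \<in> {u..v}"
  obtains k where "k < m" "t \<in> {equipartition u v m k..equipartition u v m (Suc k)}"
proof -
  define reaches where "reaches k \<longleftrightarrow> t \<le> equipartition u v m (Suc k)" for k
  define k where "k = (LEAST k. reaches k)"
  have last: "reaches (m - 1)" using assms by (simp add: reaches_def)
  then have "k \<le> m - 1" unfolding k_def by (rule Least_le)
  then have "k < m" using \<open>0 < m\<close> by linarith
  moreover have "reaches k" unfolding k_def using last by (rule LeastI)
  moreover have "equipartition u v m k \<le> t"
  proof (cases k)
    case (Suc l)
    then have "\<not> reaches l" unfolding k_def by (intro not_less_Least) simp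
    then show ?thesis by (simp add: reaches_def Suc)
  qed (use assms in simp)
  ultimately show ?thesis using that by (simp add: reaches_def)
qed

lemma mono_on_close_if_close_on_equipartition:
  fixes F g :: "real \<Rightarrow> real"
  assumes mono: "mono_on {u..v} F" and "0 < m"
    and osc: "\<And>y z. y \<in> {u..v} \<Longrightarrow> z \<in> {u..v} \<Longrightarrow> \<bar>z - y\<bar> \<le> (v - u) / real m \<Longrightarrow> \<bar>g z - g y\<bar> < e / 2"
    and close: "\<And>k. k \<le> m \<Longrightarrow> \<bar>F (equipartition u v m k) - g (equipartition u v m k)\<bar> < e / 2"
    and y_mem: "y \<in> {u..v}"
  shows "\<bar>F y - g y\<bar> < e"
proof -
  obtain k where "k < m" and "y \<in> {equipartition u v m k..equipartition u v m (Suc k)}"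
    using equipartition_cell_exists[OF \<open>0 < m\<close> y_mem] .
  moreover define l r where "l = equipartition u v m k" and "r = equipartition u v m (Suc k)"
  ultimately have between: "l \<le> y" "y \<le> r" by auto
  have ends_mem: "l \<in> {u..v}" "r \<in> {u..v}"
    using equipartition_mem_Icc[of u v m] \<open>0 < m\<close> \<open>k < m\<close> y_mem by (auto simp: l_def r_def)
  have "r - l = (v - u) / real m" by (simp add: l_def r_def equipartition_Suc_diff)
  then have "\<bar>g l - g y\<bar> < e / 2" "\<bar>g r - g y\<bar> < e / 2"
    using osc[OF y_mem ends_mem(1)] osc[OF y_mem ends_mem(2)] between by linarith+
  moreover have "F l \<le> F y" "F y \<le> F r"
    using mono_onD[OF mono] between ends_mem y_mem by blast+
  moreover have "\<bar>F l - g l\<bar> < e / 2" "\<bar>F r - g r\<bar> < e / 2"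
    using close[of k] close[of "Suc k"] \<open>k < m\<close> by (simp_all add: l_def r_def)
  ultimately show ?thesis by linarith
qed

lemma uniform_limit_mono_on:
  fixes F :: "'a \<Rightarrow> real \<Rightarrow> real"
  assumes mono: "eventually (\<lambda>n. mono_on {u..v} (F n)) L"
    and cont: "continuous_on {u..v} g"
    and lim: "\<And>y. y \<in> {u..v} \<Longrightarrow> ((\<lambda>n. F n y) \<longlongrightarrow> g y) L"
  shows "uniform_limit {u..v} F g L"
proof (cases "u \<le> v")
  case True
  show ?thesis
  proof (rule uniform_limitI)
    fix e :: real assume "0 < e"
    have "uniformly_continuous_on {u..v} g"
      using cont by (rule compact_uniformly_continuous) simp
    then obtain d where "0 < d"
        and osc: "\<And>y z. y \<in> {u..v} \<Longrightarrow> z \<in> {u..v} \<Longrightarrow> \<bar>z - y\<bar> < d \<Longrightarrow> \<bar>g z - g y\<bar> < e / 2"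
      unfolding uniformly_continuous_on_def dist_real_def using half_gt_zero[OF \<open>0 < e\<close>] by metis
    obtain m :: nat where m_large: "(v - u) / d < real m" using reals_Archimedean2 by blast
    moreover have "0 \<le> (v - u) / d" using True \<open>0 < d\<close> by simp
    ultimately have "0 < m" by (metis le_less_trans of_nat_0_less_iff)
    then have fine: "(v - u) / real m < d" using m_large \<open>0 < d\<close> by (simp add: field_simps)
    have "eventually (\<lambda>n. \<forall>k\<in>{..m}.
        dist (F n (equipartition u v m k)) (g (equipartition u v m k)) < e / 2) L"
      using lim equipartition_mem_Icc[OF True \<open>0 < m\<close>] \<open>0 < e\<close>
      by (intro eventually_ball_finite ballI tendstoD) simp_all
    with mono show "eventually (\<lambda>n. \<forall>y\<in>{u..v}. dist (F n y) (g y) < e) L"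
    proof eventually_elim
      case (elim n)
      show ?case
        using mono_on_close_if_close_on_equipartition[OF elim(1) \<open>0 < m\<close>, of g e] osc fine elim(2)
        by (auto simp: dist_real_def)
    qed
  qed
qed simp

lemma mono_on_Icc_join:
  fixes g :: "'a::linorder \<Rightarrow> 'b::preorder"
  assumes left: "mono_on {u..v} g" and right: "mono_on {v..w} g"
  shows "mono_on {u..w} g"
proof (rule mono_onI)
  fix y z assume "y \<in> {u..w}" "z \<in> {u..w}" "y \<le> z"
  note order = this
  consider "z \<le> v" | "v \<le> y" | "y \<le> v" "v \<le> z" by fastforce
  then show "g y \<le> g z"
  proof cases
    case 3
    then have "g y \<le> g v" "g v \<le> g z"
      using order by (auto intro: mono_onD[OF left] mono_onD[OF right])
    then show ?thesis by (rule order_trans)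
  qed (use order in \<open>auto intro: mono_onD[OF left] mono_onD[OF right]\<close>)
qed

lemma affine_mono_on_Icc:
  fixes g :: "real \<Rightarrow> real"
  assumes "u < v" and affine: "\<And>y. y \<in> {u..v} \<Longrightarrow> g y = p * y + q" and "g u \<le> g v"
  shows "mono_on {u..v} g"
proof (rule mono_onI)
  have "0 \<le> p * (v - u)" using assms by (simp add: right_diff_distrib)
  then have "0 \<le> p" using \<open>u < v\<close> by (simp add: zero_le_mult_iff)
  then show "g y \<le> g z" if "y \<in> {u..v}" "z \<in> {u..v}" "y \<le> z" for y z
    using that by (simp add: affine mult_left_mono)
qed

lemma is_linear_spline_mono_on:
  assumes spline: "is_linear_spline m s g" and "0 < m" and "sorted s" and "length s = m + 1"
  shows "mono_on {0..1} g"
proof -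
  have "mono_on {0..real k / real m} g" if "k \<le> m" for k
    using that
  proof (induction k)
    case 0
    then show ?case by (simp add: mono_on_def)
  next
    case (Suc k)
    have "s ! k \<le> s ! Suc k" using Suc.prems assms(3,4) by (intro sorted_nth_mono) auto
    then have "g (real k / real m) \<le> g (real (Suc k) / real m)"
      using spline Suc.prems by (simp add: is_linear_spline_def del: of_nat_Suc)
    moreover have "\<exists>p q. \<forall>y\<in>{real k / real m..real (Suc k) / real m}. g y = p * y + q"
      using spline Suc.prems unfolding is_linear_spline_def Suc_eq_plus1 by simp
    then obtain p q where
      "\<And>y. y \<in> {real k / real m..real (Suc k) / real m} \<Longrightarrow> g y = p * y + q" by blast
    moreover have "real k / real m < real (Suc k) / real m"
      using \<open>0 < m\<close> by (simp add: divide_strict_right_mono)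
    ultimately have "mono_on {real k / real m..real (Suc k) / real m} g"
      by (intro affine_mono_on_Icc)
    with Suc.IH[OF Suc_leD[OF Suc.prems]] show ?case by (rule mono_on_Icc_join)
  qed
  from this[of m] show ?thesis using \<open>0 < m\<close> by simp
qed

lemma is_linear_spline_less:
  assumes spline: "is_linear_spline m s g" and "0 < m" and "sorted s" and len: "length s = m + 1"
    and y_mem: "y \<in> {0..1}"
    and many: "y * real m + 1 \<le> real (length (filter (\<lambda>v. v < c) s))"
  shows "g y < c"
proof (rule ccontr)
  assume "\<not> g y < c"
  have "real k < y * real m" if "k < length s" "s ! k < c" for k
  proof (rule ccontr)
    assume "\<not> real k < y * real m"
    then have "y \<le> real k / real m" using \<open>0 < m\<close> by (simp add: pos_le_divide_eq)
    moreover have "real k / real m \<in> {0..1}"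
      using \<open>k < length s\<close> len \<open>0 < m\<close> by (simp add: divide_le_eq)
    ultimately have "g y \<le> g (real k / real m)"
      using y_mem mono_onD[OF is_linear_spline_mono_on[OF assms(1-4)]] by blast
    also have "\<dots> = s ! k" using spline \<open>k < length s\<close> len by (simp add: is_linear_spline_def)
    finally show False using \<open>s ! k < c\<close> \<open>\<not> g y < c\<close> by simp
  qed
  then have "{k. k < length s \<and> s ! k < c} \<subseteq> {..<nat \<lceil>y * real m\<rceil>}"
    by (auto simp: zless_nat_eq_int_zless less_ceiling_iff)
  then have "length (filter (\<lambda>v. v < c) s) \<le> nat \<lceil>y * real m\<rceil>"
    using card_mono[of "{..<nat \<lceil>y * real m\<rceil>}"] by (simp add: length_filter_conv_card)
  moreover have "0 \<le> y * real m" using y_mem by simp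
  ultimately show False using many by linarith
qed

lemma is_linear_spline_reflect:
  assumes spline: "is_linear_spline m s g" and "0 < m" and len: "length s = m + 1"
  shows "is_linear_spline m (rev (map uminus s)) (\<lambda>y. - g (1 - y))"
  unfolding is_linear_spline_def
proof (intro conjI allI impI)
  have reflected_node: "1 - real i / real m = real (m - i) / real m" if "i \<le> m" for i
    using that \<open>0 < m\<close> by (simp add: diff_divide_distrib)
  show "- g (1 - real i / real m) = rev (map uminus s) ! i" if "i \<le> m" for i
    using that spline len unfolding reflected_node[OF that] is_linear_spline_def
    by (simp add: rev_nth del: of_nat_diff)
  show "\<exists>p q. \<forall>y\<in>{real i / real m..real (i + 1) / real m}. - g (1 - y) = p * y + q"
    if "i < m" for i
  proof -
    obtain p q where affine:
      "\<And>y. y \<in> {real (m - (i + 1)) / real m..real (m - (i + 1) + 1) / real m} \<Longrightarrow> g y = p * y + q"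
      using spline \<open>i < m\<close> \<open>0 < m\<close> unfolding is_linear_spline_def
      by (metis diff_less zero_less_Suc Suc_eq_plus1)
    have "- g (1 - y) = p * y + (- p - q)" if "y \<in> {real i / real m..real (i + 1) / real m}" for y
    proof -
      have "1 - y \<in> {real (m - (i + 1)) / real m..real (m - i) / real m}"
        using that \<open>i < m\<close> reflected_node[of i] reflected_node[of "i + 1"] by auto
      moreover have "m - (i + 1) + 1 = m - i" using \<open>i < m\<close> by simp
      ultimately show ?thesis using affine[of "1 - y"] by (simp add: algebra_simps)
    qed
    then show ?thesis by blast
  qed
qed

lemma is_linear_spline_greater:
  assumes spline: "is_linear_spline m s g" and "0 < m" and "sorted s" and "length s = m + 1"
    and "y \<in> {0..1}"
    and "(1 - y) * real m + 1 \<le> real (length (filter (\<lambda>v. c < v) s))"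
  shows "c < g y"
proof -
  have "sorted (rev (map uminus s))"
    using \<open>sorted s\<close> by (simp add: sorted_wrt_rev sorted_wrt_map)
  moreover have "length (filter (\<lambda>v. v < - c) (rev (map uminus s))) = length (filter (\<lambda>v. c < v) s)"
    by (simp add: rev_filter[symmetric] filter_map comp_def)
  ultimately have "- g (1 - (1 - y)) < - c"
    using assms by (intro is_linear_spline_less[OF is_linear_spline_reflect[OF spline]]) auto
  then show ?thesis by simp
qed

section \<open>Equidistribution of asymptotically uniform grids\<close>

lemma eventually_multi_at_top:
  "eventually P (multi_at_top :: (nat ^ 'd) filter) \<longleftrightarrow> (\<exists>N. \<forall>n. (\<forall>j. N \<le> n $ j) \<longrightarrow> P n)"
  unfolding multi_at_top_def eventually_filtercomap_at_top_linorder by simp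

lemma eventually_multi_at_top_pos: "eventually (\<lambda>n :: nat ^ 'd. \<forall>j. 0 < n $ j) multi_at_top"
  unfolding eventually_multi_at_top by (auto intro: exI[of _ 1] simp: Suc_le_eq)

lemma filterlim_component_multi_at_top:
  "filterlim (\<lambda>n :: nat ^ 'd. real (n $ j)) at_top multi_at_top"
  unfolding filterlim_at_top eventually_multi_at_top by (metis nat_ceiling_le_eq)

lemma bij_betw_vec_nth_atLeastAtMost:
  "bij_betw vec_nth {m..n :: nat ^ 'd} (\<Pi>\<^sub>E j\<in>UNIV. {m $ j..n $ j})"
  by (rule bij_betw_byWitness[where f' = vec_lambda]) (auto simp: less_eq_vec_def PiE_iff)

lemma finite_atLeastAtMost_vec [simp]: "finite {m..n :: nat ^ 'd}"
  using bij_betw_finite[OF bij_betw_vec_nth_atLeastAtMost[of m n]] by (simp add: finite_PiE)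

lemma card_atLeastAtMost_one_vec: "card {1..n :: nat ^ 'd} = (\<Prod>j\<in>UNIV. n $ j)"
  using bij_betw_same_card[OF bij_betw_vec_nth_atLeastAtMost[of 1 n]] by (simp add: card_PiE)

lemma filterlim_card_atLeastAtMost_one_vec:
  "filterlim (\<lambda>n :: nat ^ 'd. real (card {1..n})) at_top multi_at_top"
proof (rule filterlim_at_top_mono[OF filterlim_component_multi_at_top])
  fix j :: 'd
  show "eventually (\<lambda>n. real (n $ j) \<le> real (card {1..n})) multi_at_top"
    using eventually_multi_at_top_pos
  proof eventually_elim
    case (elim n)
    then have "n $ j \<le> (\<Prod>j\<in>UNIV. n $ j)"
      by (intro dvd_imp_le dvd_prodI prod_pos) auto
    then show ?case by (simp only: card_atLeastAtMost_one_vec of_nat_le_iff)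
  qed
qed

definition grid_node :: "real ^ 'd \<Rightarrow> real ^ 'd \<Rightarrow> nat ^ 'd \<Rightarrow> nat ^ 'd \<Rightarrow> real ^ 'd" where
  "grid_node a b n i = (\<chi> j. equipartition (a $ j) (b $ j) (n $ j) (i $ j))"

text \<open>Cells are only considered for \<open>i \<ge> 1\<close>, where the subtraction does not truncate.\<close>

definition grid_cell :: "real ^ 'd \<Rightarrow> real ^ 'd \<Rightarrow> nat ^ 'd \<Rightarrow> nat ^ 'd \<Rightarrow> (real ^ 'd) set" where
  "grid_cell a b n i = cbox (grid_node a b n (i - 1)) (grid_node a b n i)"

lemma grid_node_diff_pred:
  assumes "i \<in> {1..n}"
  shows "grid_node a b n i $ j - grid_node a b n (i - 1) $ j = (b $ j - a $ j) / real (n $ j)"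
proof -
  have "1 \<le> i $ j" using assms by (simp add: less_eq_vec_def)
  then have "i $ j = Suc ((i - 1) $ j)" by simp
  then show ?thesis by (simp only: grid_node_def vec_lambda_beta equipartition_Suc_diff)
qed

lemma cbox_subset_grid_cells:
  assumes "\<And>j. 0 < n $ j"
  shows "cbox a b \<subseteq> (\<Union>i\<in>{1..n}. grid_cell a b n i)"
proof
  fix y assume "y \<in> cbox a b"
  then have "\<exists>k<n $ j. y $ j \<in> {equipartition (a $ j) (b $ j) (n $ j) k..
      equipartition (a $ j) (b $ j) (n $ j) (Suc k)}" for j
    using equipartition_cell_exists[of "n $ j" "y $ j" "a $ j" "b $ j"] assms
    by (metis atLeastAtMost_iff mem_box_cart(2))
  then obtain k where "\<And>j. k j < n $ j"
    and between: "\<And>j. y $ j \<in> {equipartition (a $ j) (b $ j) (n $ j) (k j)..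
      equipartition (a $ j) (b $ j) (n $ j) (Suc (k j))}"
    by metis
  define i where "i = (\<chi> j. Suc (k j))"
  have "i \<in> {1..n}" using \<open>\<And>j. k j < n $ j\<close> by (simp add: i_def less_eq_vec_def Suc_le_eq)
  moreover have "y \<in> grid_cell a b n i"
    using between by (simp add: grid_cell_def grid_node_def i_def mem_box_cart)
  ultimately show "y \<in> (\<Union>i\<in>{1..n}. grid_cell a b n i)" by blast
qed

lemma content_grid_cell:
  assumes "a \<le> b" and "i \<in> {1..n}"
  shows "measure lborel (grid_cell a b n i) = measure lborel (cbox a b) / real (card {1..n})"
proof -
  have "0 \<le> (b $ j - a $ j) / real (n $ j)" for j using \<open>a \<le> b\<close> by (simp add: less_eq_vec_def)
  then have "grid_node a b n (i - 1) $ j \<le> grid_node a b n i $ j" for j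
    using grid_node_diff_pred[OF assms(2), of a b j] by (metis diff_ge_0_iff_ge)
  then have "measure lborel (grid_cell a b n i) = (\<Prod>j\<in>UNIV. (b $ j - a $ j) / real (n $ j))"
    using grid_node_diff_pred[OF assms(2)]
    by (simp add: grid_cell_def content_cbox_cart interval_ne_empty_cart)
  also have "\<dots> = measure lborel (cbox a b) / real (card {1..n})"
    using \<open>a \<le> b\<close>
    by (simp add: content_cbox_cart interval_ne_empty_cart less_eq_vec_def prod_dividef
        card_atLeastAtMost_one_vec)
  finally show ?thesis .
qed

lemma dist_grid_cell_less:
  fixes p :: "real ^ 'd"
  assumes "i \<in> {1..n}" and "y \<in> grid_cell a b n i"
    and step: "\<And>j. (b $ j - a $ j) / real (n $ j) < \<delta>" and "infnorm (p - grid_node a b n i) < \<delta>"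
  shows "dist y p < 2 * \<delta> * CARD('d)"
proof -
  have "\<bar>(y - p) $ j\<bar> < 2 * \<delta>" for j
  proof -
    have "\<bar>p $ j - grid_node a b n i $ j\<bar> < \<delta>"
      using component_le_infnorm_cart[of "p - grid_node a b n i" j] assms(4) by simp
    moreover have "grid_node a b n (i - 1) $ j \<le> y $ j" "y $ j \<le> grid_node a b n i $ j"
      using assms(2) by (simp_all add: grid_cell_def mem_box_cart)
    moreover have "grid_node a b n i $ j - grid_node a b n (i - 1) $ j < \<delta>"
      using step grid_node_diff_pred[OF assms(1)] by simp
    ultimately show ?thesis by simp
  qed
  then have "(\<Sum>j\<in>UNIV. \<bar>(y - p) $ j\<bar>) < (\<Sum>j\<in>(UNIV :: 'd set). 2 * \<delta>)"
    by (intro sum_strict_mono) auto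
  then show ?thesis
    using norm_le_l1_cart[of "y - p"] by (simp add: dist_norm mult.commute)
qed

lemma eventually_grid_cells_near:
  fixes a b :: "real ^ 'd"
  assumes grid: "asymptotically_uniform_grid a b x" and "0 < \<epsilon>"
  shows "eventually (\<lambda>n. \<forall>i\<in>{1..n}. \<forall>y\<in>grid_cell a b n i. dist y (x n i) < \<epsilon>) multi_at_top"
proof -
  define \<delta> where "\<delta> = \<epsilon> / (2 * real CARD('d))"
  have "0 < \<delta>" using \<open>0 < \<epsilon>\<close> by (simp add: \<delta>_def)
  have "((\<lambda>n. (b $ j - a $ j) / real (n $ j)) \<longlongrightarrow> 0) multi_at_top" for j
    using tendsto_const filterlim_component_multi_at_top by (rule real_tendsto_divide_at_top)
  then have "eventually (\<lambda>n. \<forall>j. (b $ j - a $ j) / real (n $ j) < \<delta>) multi_at_top"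
    using \<open>0 < \<delta>\<close> by (intro eventually_all_finite order_tendstoD(2))
  moreover have
    "eventually (\<lambda>n. Max ((\<lambda>i. infnorm (x n i - grid_node a b n i)) ` {1..n}) < \<delta>) multi_at_top"
    using order_tendstoD(2)[OF grid[unfolded asymptotically_uniform_grid_def] \<open>0 < \<delta>\<close>]
    by (simp add: grid_node_def equipartition_def)
  ultimately show ?thesis
  proof eventually_elim
    case (elim n)
    show ?case
    proof (intro ballI)
      fix i y assume "i \<in> {1..n}" and "y \<in> grid_cell a b n i"
      moreover have "infnorm (x n i - grid_node a b n i) < \<delta>"
        using elim(2) \<open>i \<in> {1..n}\<close> by (subst (asm) Max_less_iff) auto
      ultimately have "dist y (x n i) < 2 * \<delta> * CARD('d)"
        using elim(1) by (intro dist_grid_cell_less) auto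
      then show "dist y (x n i) < \<epsilon>" by (simp add: \<delta>_def)
    qed
  qed
qed

lemma finite_grid_indices [simp]: "finite (grid_indices A x n)"
  by (rule finite_subset[of _ "{1..n}"]) (auto simp: grid_indices_def)

lemma grid_indices_mono: "A \<subseteq> B \<Longrightarrow> grid_indices A x n \<subseteq> grid_indices B x n"
  by (auto simp: grid_indices_def)

definition grid_fraction ::
  "(real ^ 'd) set \<Rightarrow> (nat ^ 'd \<Rightarrow> nat ^ 'd \<Rightarrow> real ^ 'd) \<Rightarrow> nat ^ 'd \<Rightarrow> real" where
  "grid_fraction A x n = real (card (grid_indices A x n)) / real (card {1..n})"

lemma grid_fraction_mono: "A \<subseteq> B \<Longrightarrow> grid_fraction A x n \<le> grid_fraction B x n"
  unfolding grid_fraction_def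
  by (intro divide_right_mono of_nat_mono card_mono grid_indices_mono) auto

lemma grid_fraction_disjoint_le:
  assumes "A \<inter> B = {}"
  shows "grid_fraction A x n + grid_fraction B x n \<le> 1"
proof -
  have "card (grid_indices A x n) + card (grid_indices B x n)
      = card (grid_indices A x n \<union> grid_indices B x n)"
    using assms by (intro card_Un_disjoint[symmetric] finite_grid_indices)
      (auto simp: grid_indices_def)
  also have "\<dots> \<le> card {1..n}" by (intro card_mono) (auto simp: grid_indices_def)
  finally have "real (card (grid_indices A x n)) + real (card (grid_indices B x n))
      \<le> real (card {1..n})"
    by linarith
  then show ?thesis
    by (simp add: grid_fraction_def add_divide_distrib[symmetric] divide_le_eq)
qed

lemma measure_le_grid_fraction:
  assumes "a \<le> b" and n_pos: "\<And>j. 0 < n $ j"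
    and "K \<in> lmeasurable" and "K \<subseteq> cbox a b"
    and near: "\<And>i. i \<in> {1..n} \<Longrightarrow> grid_cell a b n i \<inter> K \<noteq> {} \<Longrightarrow> x n i \<in> V"
  shows "measure lebesgue K \<le> grid_fraction V x n * measure lborel (cbox a b)"
proof -
  have "K \<subseteq> (\<Union>i\<in>grid_indices V x n. grid_cell a b n i)"
  proof
    fix y assume "y \<in> K"
    then obtain i where "i \<in> {1..n}" "y \<in> grid_cell a b n i"
      using cbox_subset_grid_cells[OF n_pos, of a b] \<open>K \<subseteq> cbox a b\<close> by blast
    moreover from this have "i \<in> grid_indices V x n"
      using near \<open>y \<in> K\<close> unfolding grid_indices_def by blast
    ultimately show "y \<in> (\<Union>i\<in>grid_indices V x n. grid_cell a b n i)" by blast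
  qed
  then have "measure lebesgue K \<le> measure lebesgue (\<Union>i\<in>grid_indices V x n. grid_cell a b n i)"
    using \<open>K \<in> lmeasurable\<close> by (intro measure_mono_fmeasurable fmeasurable.finite_UN)
      (auto simp: grid_cell_def fmeasurableD)
  also have "\<dots> \<le> (\<Sum>i\<in>grid_indices V x n. measure lebesgue (grid_cell a b n i))"
    by (intro measure_UNION_le) (auto simp: grid_cell_def)
  also have "\<dots> = (\<Sum>i\<in>grid_indices V x n. measure lborel (cbox a b) / real (card {1..n}))"
    using content_grid_cell[OF \<open>a \<le> b\<close>, of _ n]
    by (intro sum.cong) (auto simp: grid_cell_def grid_indices_def)
  also have "\<dots> = grid_fraction V x n * measure lborel (cbox a b)"
    by (simp add: grid_fraction_def)
  finally show ?thesis .
qed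

lemma lmeasurable_inner_compact:
  fixes S :: "'a::euclidean_space set"
  assumes "S \<in> lmeasurable" and "bounded S" and less: "r < measure lebesgue S"
  obtains K where "compact K" "K \<subseteq> S" "r < measure lebesgue K"
proof -
  obtain K where "closed K" "K \<subseteq> S" and diff: "S - K \<in> lmeasurable"
      "emeasure lebesgue (S - K) < ennreal (measure lebesgue S - r)"
    using sets_lebesgue_inner_closed[of S "measure lebesgue S - r"] assms
    by (auto simp: fmeasurableD)
  then have "compact K" using \<open>bounded S\<close> bounded_subset compact_eq_bounded_closed by blast
  then have "measure lebesgue (S - K) = measure lebesgue S - measure lebesgue K"
    using \<open>K \<subseteq> S\<close> \<open>S \<in> lmeasurable\<close>
    by (simp add: measurable_measure_Diff lmeasurable_compact fmeasurableD)
  moreover have "measure lebesgue (S - K) < measure lebesgue S - r"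
    using diff less by (simp add: emeasure_eq_measure2 ennreal_less_iff)
  ultimately show ?thesis using that \<open>compact K\<close> \<open>K \<subseteq> S\<close> by auto
qed

lemma eventually_grid_fraction_open_gt:
  fixes a b :: "real ^ 'd"
  assumes grid: "asymptotically_uniform_grid a b x" and "open V"
    and less: "r * measure lborel (cbox a b) < measure lebesgue (V \<inter> cbox a b)"
  shows "eventually (\<lambda>n. r < grid_fraction V x n) multi_at_top"
proof -
  have "cbox a b \<noteq> {}" using less by auto
  then have "a \<le> b" by (simp add: cbox_interval)
  have "V \<inter> cbox a b \<in> lmeasurable"
    using \<open>open V\<close> by (intro bounded_set_imp_lmeasurable) (auto intro: bounded_Int)
  then obtain K where "compact K" "K \<subseteq> V \<inter> cbox a b"
      and K_large: "r * measure lborel (cbox a b) < measure lebesgue K"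
    using lmeasurable_inner_compact less by (metis bounded_Int bounded_cbox)
  have "K \<inter> - V = {}" using \<open>K \<subseteq> V \<inter> cbox a b\<close> by blast
  then obtain \<epsilon> where "0 < \<epsilon>" and separated: "\<And>p q. p \<in> K \<Longrightarrow> q \<in> - V \<Longrightarrow> \<epsilon> \<le> dist p q"
    using separate_compact_closed \<open>compact K\<close> \<open>open V\<close> by (metis closed_Compl)
  show ?thesis
    using eventually_grid_cells_near[OF grid \<open>0 < \<epsilon>\<close>] eventually_multi_at_top_pos
  proof eventually_elim
    case (elim n)
    have "x n i \<in> V" if "i \<in> {1..n}" "grid_cell a b n i \<inter> K \<noteq> {}" for i
      using elim(1) that separated by (metis ComplI Int_emptyI not_le)
    then have "measure lebesgue K \<le> grid_fraction V x n * measure lborel (cbox a b)"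
      using elim(2) \<open>compact K\<close> \<open>K \<subseteq> V \<inter> cbox a b\<close> \<open>a \<le> b\<close>
      by (intro measure_le_grid_fraction) (auto intro: lmeasurable_compact)
    then have "r * measure lborel (cbox a b) < grid_fraction V x n * measure lborel (cbox a b)"
      using K_large by linarith
    then show ?case by (simp add: mult_less_cancel_right)
  qed
qed

lemma measure_Int_negligible_frontier:
  fixes A :: "'a::euclidean_space set"
  assumes "negligible (frontier A)" and between: "interior A \<subseteq> B" "B \<subseteq> closure A"
    and "B \<inter> C \<in> lmeasurable"
  shows "measure lebesgue (A \<inter> C) = measure lebesgue (B \<inter> C)"
proof (rule measure_negligible_symdiff[OF assms(4) negligible_subset[OF assms(1)]])
  show "B \<inter> C - A \<inter> C \<union> (A \<inter> C - B \<inter> C) \<subseteq> frontier A"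
    using between interior_subset[of A] closure_subset[of A] unfolding frontier_def by blast
qed

lemma measure_Compl_closure_Int_cbox:
  fixes a b :: "'a::euclidean_space"
  assumes "negligible (frontier A)"
  shows "measure lebesgue (- closure A \<inter> cbox a b)
    = measure lborel (cbox a b) - measure lebesgue (A \<inter> cbox a b)"
proof -
  have closure: "closure A \<inter> cbox a b \<in> lmeasurable"
    by (intro bounded_set_imp_lmeasurable) (auto intro: bounded_Int borel_closed)
  have "- closure A \<inter> cbox a b = cbox a b - closure A \<inter> cbox a b" by blast
  then have "measure lebesgue (- closure A \<inter> cbox a b)
      = measure lborel (cbox a b) - measure lebesgue (closure A \<inter> cbox a b)"
    using closure by (simp add: measurable_measure_Diff fmeasurableD)
  also have "measure lebesgue (closure A \<inter> cbox a b) = measure lebesgue (A \<inter> cbox a b)"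
    using closure by (intro measure_Int_negligible_frontier[symmetric] assms order_refl
        order_trans[OF interior_subset closure_subset])
  finally show ?thesis .
qed

theorem tendsto_grid_fraction:
  fixes a b :: "real ^ 'd"
  assumes grid: "asymptotically_uniform_grid a b x" and volume_pos: "0 < measure lborel (cbox a b)"
    and null: "negligible (frontier A)"
  shows "(grid_fraction A x \<longlongrightarrow> measure lebesgue (A \<inter> cbox a b) / measure lborel (cbox a b))
    multi_at_top"
proof (rule order_tendstoI)
  let ?R = "cbox a b"
  fix r assume r_less: "r < measure lebesgue (A \<inter> ?R) / measure lborel ?R"
  have "measure lebesgue (A \<inter> ?R) = measure lebesgue (interior A \<inter> ?R)"
    by (intro measure_Int_negligible_frontier[OF null] bounded_set_imp_lmeasurable order_refl
        order_trans[OF interior_subset closure_subset]) (auto intro: bounded_Int)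
  then have "r * measure lborel ?R < measure lebesgue (interior A \<inter> ?R)"
    using r_less volume_pos by (simp add: pos_less_divide_eq)
  from eventually_grid_fraction_open_gt[OF grid open_interior this]
  show "eventually (\<lambda>n. r < grid_fraction A x n) multi_at_top"
    by eventually_elim (erule less_le_trans[OF _ grid_fraction_mono[OF interior_subset]])
next
  let ?R = "cbox a b"
  fix r assume "measure lebesgue (A \<inter> ?R) / measure lborel ?R < r"
  then have "(1 - r) * measure lborel ?R < measure lebesgue (- closure A \<inter> ?R)"
    using volume_pos
    by (simp add: measure_Compl_closure_Int_cbox[OF null] pos_divide_less_eq left_diff_distrib)
  then have "eventually (\<lambda>n. 1 - r < grid_fraction (- closure A) x n) multi_at_top"
    by (intro eventually_grid_fraction_open_gt[OF grid]) auto
  then show "eventually (\<lambda>n. grid_fraction A x n < r) multi_at_top"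
  proof eventually_elim
    case (elim n)
    have "A \<inter> - closure A = {}" using closure_subset[of A] by blast
    from grid_fraction_disjoint_le[OF this, of x n] elim show ?case by linarith
  qed
qed

section \<open>Quantiles of distributions with connected support\<close>

locale connected_support_distribution = cdf_distribution M for M +
  fixes R :: "real set"
  assumes connected_R: "connected R"
    and full_measure: "S \<in> sets borel \<Longrightarrow> R \<subseteq> S \<Longrightarrow> measure M S = 1"
    and open_pos: "open S \<Longrightarrow> S \<inter> R \<noteq> {} \<Longrightarrow> 0 < measure M S"
begin

lemma disjoint_measure_sum_le_1:
  assumes "S \<in> sets borel" and "T \<in> sets borel" and "S \<inter> T = {}"
  shows "measure M S + measure M T \<le> 1"
  using finite_measure_Union[of S T] prob_le_1[of "S \<union> T"] assms by simp

lemma null_outside: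
  assumes "S \<in> sets borel" and "S \<inter> R = {}"
  shows "measure M S = 0"
proof -
  have "measure M (- S) = 1" using assms by (intro full_measure) auto
  then show ?thesis
    using disjoint_measure_sum_le_1[of S "- S"] assms(1) measure_nonneg[of M S] by simp
qed

lemma R_nonempty: "R \<noteq> {}"
  using full_measure[of "{}"] by auto

text \<open>The second alternative lets the endpoints take part in the same argument: for \<open>y = 1\<close> and
  \<open>R \<subseteq> S\<close> the first inequality degenerates to an equality.\<close>

definition exceeds :: "real \<Rightarrow> real set \<Rightarrow> bool" where
  "exceeds y S \<longleftrightarrow> y < measure M S \<or> R \<subseteq> S"

lemma exceeds_complementary_not_disjoint:
  assumes "S \<in> sets borel" "exceeds y S" and "T \<in> sets borel" "exceeds (1 - y) T"
    and "y \<in> {0..1}"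
  shows "S \<inter> T \<noteq> {}"
proof
  assume "S \<inter> T = {}"
  then have "measure M S + measure M T \<le> 1" and "\<not> (R \<subseteq> S \<and> R \<subseteq> T)"
    using assms(1,3) R_nonempty by (simp_all add: disjoint_measure_sum_le_1) blast
  then show False
    using assms full_measure[of S] full_measure[of T] unfolding exceeds_def by fastforce
qed

lemma eventually_exceeds:
  assumes "exceeds y S" and "(h \<longlongrightarrow> y) L"
  shows "eventually (\<lambda>t. exceeds (h t) S) L"
  using assms(1) unfolding exceeds_def
proof
  assume "y < measure M S"
  from order_tendstoD(2)[OF assms(2) this]
  show "eventually (\<lambda>t. h t < measure M S \<or> R \<subseteq> S) L" by eventually_elim simp
qed simp

definition quantile_at :: "real \<Rightarrow> real \<Rightarrow> bool" where
  "quantile_at y q \<longleftrightarrow> (\<forall>c<q. exceeds (1 - y) {c<..}) \<and> (\<forall>c>q. exceeds y {..<c})"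

lemma quantile_at_le:
  assumes "quantile_at y q" and "y \<in> {0..1}" and "exceeds y {..<c}"
  shows "q \<le> c"
proof (rule ccontr)
  assume "\<not> q \<le> c"
  then have "exceeds (1 - y) {c<..}" using assms(1) by (simp add: quantile_at_def)
  with assms(2,3) have "{..<c} \<inter> {c<..} \<noteq> {}"
    by (intro exceeds_complementary_not_disjoint) auto
  then show False by auto
qed

lemma quantile_at_ge:
  assumes "quantile_at y q" and "y \<in> {0..1}" and "exceeds (1 - y) {c<..}"
  shows "c \<le> q"
proof (rule ccontr)
  assume "\<not> c \<le> q"
  then have "exceeds y {..<c}" using assms(1) by (simp add: quantile_at_def)
  with assms(2,3) have "{..<c} \<inter> {c<..} \<noteq> {}"
    by (intro exceeds_complementary_not_disjoint) auto
  then show False by auto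
qed

lemma tendsto_quantile_at:
  assumes quantile: "quantile_at y q"
    and near: "eventually (\<lambda>t. t \<in> {0..1} \<and> quantile_at t (g t)) (at y within A)"
  shows "(g \<longlongrightarrow> q) (at y within A)"
proof (rule order_tendstoI)
  fix c assume "c < q"
  then obtain d where "c < d" "d < q" using dense by blast
  then have "exceeds (1 - y) {d<..}" using quantile by (simp add: quantile_at_def)
  then have "eventually (\<lambda>t. exceeds (1 - t) {d<..}) (at y within A)"
    by (rule eventually_exceeds) (intro tendsto_intros)
  with near show "eventually (\<lambda>t. c < g t) (at y within A)"
    by eventually_elim (use quantile_at_ge \<open>c < d\<close> in \<open>meson less_le_trans\<close>)
next
  fix c assume "q < c"
  then obtain d where "q < d" "d < c" using dense by blast
  then have "exceeds y {..<d}" using quantile by (simp add: quantile_at_def)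
  then have "eventually (\<lambda>t. exceeds t {..<d}) (at y within A)"
    by (rule eventually_exceeds) (rule tendsto_ident_at)
  with near show "eventually (\<lambda>t. g t < c) (at y within A)"
    by eventually_elim (use quantile_at_le \<open>d < c\<close> in \<open>meson le_less_trans\<close>)
qed

text \<open>Connectedness excludes gaps in \<open>R\<close>, across which the quantile function would jump.\<close>

lemma measure_Ioo_pos:
  assumes "u < c" and "{..u} \<inter> R \<noteq> {}" and "{c..} \<inter> R \<noteq> {}"
  shows "0 < measure M {u<..<c}"
proof (rule open_pos)
  obtain v w where "v \<in> R" "v \<le> u" "w \<in> R" "c \<le> w" using assms(2,3) by auto
  moreover have "v \<le> (u + c) / 2" "(u + c) / 2 \<le> w" using calculation \<open>u < c\<close> by auto
  ultimately have "(u + c) / 2 \<in> R" using connected_R by (meson connectedD_interval)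
  moreover have "(u + c) / 2 \<in> {u<..<c}" using \<open>u < c\<close> by auto
  ultimately show "{u<..<c} \<inter> R \<noteq> {}" by blast
qed simp

lemma quantile_at_Inf_cdf:
  assumes "0 < y" and "y < 1"
  shows "quantile_at y (Inf {u. y \<le> cdf M u})"
  unfolding quantile_at_def
proof (intro conjI allI impI)
  fix c assume "c < Inf {u. y \<le> cdf M u}"
  then have "measure M {..c} < y" using pseudoinverse[OF assms, of c] by (simp add: cdf_def2)
  moreover have "- {..c} = {c<..}" by auto
  ultimately show "exceeds (1 - y) {c<..}"
    using prob_compl[of "{..c}"] by (simp add: exceeds_def Compl_eq_Diff_UNIV)
next
  define q where "q = Inf {u. y \<le> cdf M u}"
  fix c assume "Inf {u. y \<le> cdf M u} < c"
  then have "q < c" by (simp add: q_def)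
  show "exceeds y {..<c}"
  proof (cases "R \<subseteq> {..<c}")
    case False
    have y_le: "y \<le> measure M {..q}"
      using pseudoinverse[OF assms, of q] by (simp add: q_def cdf_def2)
    moreover have "0 < measure M {q<..<c}"
    proof (rule measure_Ioo_pos[OF \<open>q < c\<close>])
      show "{..q} \<inter> R \<noteq> {}" using null_outside[of "{..q}"] y_le \<open>0 < y\<close> by fastforce
      show "{c..} \<inter> R \<noteq> {}" using False by (auto simp: disjoint_iff not_less)
    qed
    moreover have "measure M ({..q} \<union> {q<..<c}) = measure M {..q} + measure M {q<..<c}"
      by (intro finite_measure_Union) auto
    moreover have "{..q} \<union> {q<..<c} = {..<c}" using \<open>q < c\<close> by auto
    ultimately show ?thesis by (simp add: exceeds_def)
  qed (simp add: exceeds_def)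
qed

lemma quantile_at_0_Inf:
  assumes "bdd_below R"
  shows "quantile_at 0 (Inf R)"
  unfolding quantile_at_def
proof (intro conjI allI impI)
  fix c assume "c < Inf R"
  then have "R \<subseteq> {c<..}" using cInf_lower[OF _ assms] by fastforce
  then show "exceeds (1 - 0) {c<..}" by (simp add: exceeds_def)
next
  fix c assume "Inf R < c"
  then obtain v where "v \<in> R" "v < c" using cInf_lessD[OF R_nonempty] by blast
  then have "{..<c} \<inter> R \<noteq> {}" by blast
  then show "exceeds 0 {..<c}" using open_pos by (simp add: exceeds_def)
qed

lemma quantile_at_1_Sup:
  assumes "bdd_above R"
  shows "quantile_at 1 (Sup R)"
  unfolding quantile_at_def
proof (intro conjI allI impI)
  fix c assume "Sup R < c"
  then have "R \<subseteq> {..<c}" using cSup_upper[OF _ assms] by fastforce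
  then show "exceeds 1 {..<c}" by (simp add: exceeds_def)
next
  fix c assume "c < Sup R"
  then obtain v where "v \<in> R" "c < v" using less_cSupD[OF R_nonempty] by blast
  then have "{c<..} \<inter> R \<noteq> {}" by blast
  then show "exceeds (1 - 1) {c<..}" using open_pos by (simp add: exceeds_def)
qed

end

section \<open>The law of a continuous function on a regular domain\<close>

locale regular_domain =
  fixes \<Omega> :: "(real ^ 'd) set"
  assumes regular: "regular_set \<Omega>"
    and emeasure_pos: "0 < emeasure lebesgue \<Omega>"
begin

lemma bounded: "bounded \<Omega>" and negligible_frontier: "negligible (frontier \<Omega>)"
  using regular by (auto simp: regular_set_def negligible_iff_null_sets)

lemma lmeasurable: "\<Omega> \<in> lmeasurable"
  by (rule measurable_Jordan[OF bounded negligible_frontier])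

lemma measure_pos: "0 < measure lebesgue \<Omega>"
  using emeasure_pos lmeasurable by (simp add: emeasure_eq_measure2)

lemma emeasure_lebesgue_on_domain: "emeasure (lebesgue_on \<Omega>) \<Omega> = ennreal (measure lebesgue \<Omega>)"
  using lmeasurable by (simp add: emeasure_restrict_space emeasure_eq_measure2 fmeasurableD)

end

locale continuous_function_on_domain = regular_domain \<Omega> for \<Omega> :: "(real ^ 'd) set" +
  fixes f :: "real ^ 'd \<Rightarrow> real"
  assumes connected: "connected \<Omega>"
    and subset_closure_interior: "\<Omega> \<subseteq> closure (interior \<Omega>)"
    and continuous: "continuous_on \<Omega> f"
begin

definition law :: "real measure" where
  "law = distr (uniform_measure (lebesgue_on \<Omega>) \<Omega>) borel f"

lemma borel_measurable_lebesgue_on: "f \<in> borel_measurable (lebesgue_on \<Omega>)"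
  using continuous lmeasurable
  by (simp add: continuous_imp_measurable_on_sets_lebesgue fmeasurableD)

lemma borel_measurable_uniform_measure: "f \<in> borel_measurable (uniform_measure (lebesgue_on \<Omega>) \<Omega>)"
  using borel_measurable_lebesgue_on by (simp cong: measurable_cong_sets)

lemma measure_law:
  assumes "S \<in> sets borel"
  shows "measure law S = measure lebesgue {z \<in> \<Omega>. f z \<in> S} / measure lebesgue \<Omega>"
proof -
  have preimage: "f -` S \<inter> \<Omega> \<in> sets (lebesgue_on \<Omega>)"
    using measurable_sets[OF borel_measurable_lebesgue_on assms] by simp
  have "measure law S = measure (uniform_measure (lebesgue_on \<Omega>) \<Omega>) (f -` S \<inter> \<Omega>)"
    using assms borel_measurable_uniform_measure by (simp add: law_def measure_distr)
  also have "\<dots> = measure (lebesgue_on \<Omega>) (\<Omega> \<inter> (f -` S \<inter> \<Omega>)) / measure (lebesgue_on \<Omega>) \<Omega>"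
    using preimage measure_pos
    by (intro measure_uniform_measure) (auto simp: emeasure_lebesgue_on_domain)
  also have "\<dots> = measure lebesgue (f -` S \<inter> \<Omega>) / measure lebesgue \<Omega>"
    using lmeasurable by (simp add: measure_restrict_space fmeasurableD Int_commute)
  also have "f -` S \<inter> \<Omega> = {z \<in> \<Omega>. f z \<in> S}" by auto
  finally show ?thesis .
qed

lemma open_interior_preimage:
  assumes "open S"
  shows "open {z \<in> interior \<Omega>. f z \<in> S}"
proof -
  have "continuous_on (interior \<Omega>) f"
    using continuous interior_subset continuous_on_subset by blast
  from continuous_open_preimage[OF this open_interior assms] show ?thesis
    by (simp add: vimage_def Int_def)
qed

lemma lmeasurable_interior_preimage:
  assumes "open S"
  shows "{z \<in> interior \<Omega>. f z \<in> S} \<in> lmeasurable"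
  using interior_subset[of \<Omega>]
  by (intro lmeasurable_open[OF bounded_subset[OF bounded] open_interior_preimage[OF assms]]) auto

lemma measure_law_open:
  assumes "open S"
  shows "measure law S = measure lebesgue {z \<in> interior \<Omega>. f z \<in> S} / measure lebesgue \<Omega>"
proof -
  have "measure lebesgue (\<Omega> \<inter> {z. f z \<in> S}) = measure lebesgue (interior \<Omega> \<inter> {z. f z \<in> S})"
    using lmeasurable_interior_preimage[OF assms] interior_subset[of \<Omega>] closure_subset[of \<Omega>]
    by (intro measure_Int_negligible_frontier[OF negligible_frontier]) (auto simp: Int_def)
  then show ?thesis using assms by (simp add: measure_law Int_def)
qed

lemma measure_law_open_pos:
  assumes "open S" and "S \<inter> f ` \<Omega> \<noteq> {}"
  shows "0 < measure law S"
proof -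
  obtain T where "open T" and preimage: "f -` S \<inter> \<Omega> = T \<inter> \<Omega>"
    using continuous assms(1) by (metis continuous_on_open_invariant)
  have "T \<inter> closure (interior \<Omega>) \<noteq> {}" using preimage assms(2) subset_closure_interior by blast
  then have "T \<inter> interior \<Omega> \<noteq> {}" using \<open>open T\<close> by (simp add: open_Int_closure_eq_empty)
  then have "{z \<in> interior \<Omega>. f z \<in> S} \<noteq> {}" using preimage interior_subset[of \<Omega>] by blast
  then have "measure lebesgue {z \<in> interior \<Omega>. f z \<in> S} \<noteq> 0"
    using open_not_negligible[OF open_interior_preimage[OF assms(1)]]
      lmeasurable_interior_preimage[OF assms(1)] negligible_iff_measure by blast
  then show ?thesis
    using measure_pos by (simp add: measure_law_open[OF assms(1)] zero_less_measure_iff)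
qed

lemma cdf_distribution_law: "cdf_distribution law"
proof -
  interpret prob_space "uniform_measure (lebesgue_on \<Omega>) \<Omega>"
    using measure_pos
    by (intro prob_space_uniform_measure) (auto simp: emeasure_lebesgue_on_domain)
  show ?thesis
    unfolding cdf_distribution_def law_def
    using borel_measurable_uniform_measure by (rule real_distribution_distr)
qed

sublocale law: connected_support_distribution law "f ` \<Omega>"
proof (intro connected_support_distribution.intro cdf_distribution_law
    connected_support_distribution_axioms.intro measure_law_open_pos)
  show "connected (f ` \<Omega>)" using continuous connected by (rule connected_continuous_image)
  show "measure law S = 1" if "S \<in> sets borel" "f ` \<Omega> \<subseteq> S" for S
  proof -
    have "{z \<in> \<Omega>. f z \<in> S} = \<Omega>" using that(2) by auto
    then show ?thesis using that(1) measure_pos by (simp add: measure_law)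
  qed
qed

lemma rearr_open_eq_Inf_cdf: "rearr_open \<Omega> f y = Inf {u. y \<le> cdf law u}"
  by (simp add: rearr_open_def cdf_def2 measure_law)

lemma quantile_at_rearr_open: "0 < y \<Longrightarrow> y < 1 \<Longrightarrow> law.quantile_at y (rearr_open \<Omega> f y)"
  unfolding rearr_open_eq_Inf_cdf by (rule law.quantile_at_Inf_cdf)

lemma monotone_rearrangement_0:
  assumes "bdd_below (f ` \<Omega>)"
  shows "monotone_rearrangement \<Omega> f 0 = Inf (f ` \<Omega>)"
proof -
  have "eventually (\<lambda>y. y \<in> {0..1} \<and> law.quantile_at y (rearr_open \<Omega> f y)) (at_right (0::real))"
    using eventually_at_right_real[OF zero_less_one]
    by eventually_elim (simp add: quantile_at_rearr_open)
  then have "(rearr_open \<Omega> f \<longlongrightarrow> Inf (f ` \<Omega>)) (at_right 0)"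
    by (rule law.tendsto_quantile_at[OF law.quantile_at_0_Inf[OF assms]])
  then show ?thesis by (simp add: monotone_rearrangement_def tendsto_Lim)
qed

lemma monotone_rearrangement_1:
  assumes "bdd_above (f ` \<Omega>)"
  shows "monotone_rearrangement \<Omega> f 1 = Sup (f ` \<Omega>)"
proof -
  have "eventually (\<lambda>y. y \<in> {0..1} \<and> law.quantile_at y (rearr_open \<Omega> f y)) (at_left (1::real))"
    using eventually_at_left_real[OF zero_less_one]
    by eventually_elim (simp add: quantile_at_rearr_open)
  then have "(rearr_open \<Omega> f \<longlongrightarrow> Sup (f ` \<Omega>)) (at_left 1)"
    by (rule law.tendsto_quantile_at[OF law.quantile_at_1_Sup[OF assms]])
  then show ?thesis by (simp add: monotone_rearrangement_def tendsto_Lim)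
qed

lemma quantile_at_monotone_rearrangement:
  assumes "y \<in> {0..1}" and "y = 0 \<Longrightarrow> bdd_below (f ` \<Omega>)" and "y = 1 \<Longrightarrow> bdd_above (f ` \<Omega>)"
  shows "law.quantile_at y (monotone_rearrangement \<Omega> f y)"
proof -
  consider "y = 0" | "y = 1" | "0 < y" "y < 1" using assms(1) by fastforce
  then show ?thesis
  proof cases
    case 3
    then show ?thesis using quantile_at_rearr_open by (simp add: monotone_rearrangement_def)
  qed (use assms in \<open>simp_all add: monotone_rearrangement_0 law.quantile_at_0_Inf
        monotone_rearrangement_1 law.quantile_at_1_Sup\<close>)
qed

lemma continuous_on_monotone_rearrangement:
  assumes "A \<subseteq> {0..1}" and "0 \<in> A \<Longrightarrow> bdd_below (f ` \<Omega>)" and "1 \<in> A \<Longrightarrow> bdd_above (f ` \<Omega>)"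
  shows "continuous_on A (monotone_rearrangement \<Omega> f)"
  unfolding continuous_on_def
proof
  have quantile: "t \<in> {0..1} \<and> law.quantile_at t (monotone_rearrangement \<Omega> f t)" if "t \<in> A" for t
    using that assms by (auto intro: quantile_at_monotone_rearrangement)
  fix y assume "y \<in> A"
  with quantile have "law.quantile_at y (monotone_rearrangement \<Omega> f y)" by blast
  then show "(monotone_rearrangement \<Omega> f \<longlongrightarrow> monotone_rearrangement \<Omega> f y) (at y within A)"
    by (rule law.tendsto_quantile_at) (use quantile in \<open>simp add: eventually_at_filter\<close>)
qed

end

section \<open>Convergence of the sample splines\<close>

lemma sorted_sorted_samples: "sorted (sorted_samples \<Omega> f x n)"
  by (simp add: sorted_samples_def)

lemma length_filter_sorted_samples:
  "length (filter P (sorted_samples \<Omega> f x n)) = card (grid_indices {z \<in> \<Omega>. P (f z)} x n)"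
proof -
  have "length (filter P (sorted_samples \<Omega> f x n))
      = size (filter_mset P (mset (sorted_samples \<Omega> f x n)))"
    by (metis mset_filter size_mset)
  also have "\<dots> = size (filter_mset (\<lambda>i. P (f (x n i))) (mset_set (grid_indices \<Omega> x n)))"
    by (simp add: sorted_samples_def filter_mset_image_mset)
  also have "\<dots> = card {i \<in> grid_indices \<Omega> x n. P (f (x n i))}"
    by (simp add: filter_mset_mset_set)
  also have "{i \<in> grid_indices \<Omega> x n. P (f (x n i))} = grid_indices {z \<in> \<Omega>. P (f z)} x n"
    by (auto simp: grid_indices_def)
  finally show ?thesis .
qed

lemma length_sorted_samples: "length (sorted_samples \<Omega> f x n) = card (grid_indices \<Omega> x n)"
  using length_filter_sorted_samples[of "\<lambda>_. True" \<Omega> f x n] by simp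

locale grid_sampled_domain = regular_domain \<Omega> for \<Omega> :: "(real ^ 'd) set" +
  fixes a b :: "real ^ 'd" and x :: "nat ^ 'd \<Rightarrow> nat ^ 'd \<Rightarrow> real ^ 'd"
  assumes subset_cbox: "\<Omega> \<subseteq> cbox a b"
    and grid: "asymptotically_uniform_grid a b x"
begin

lemma volume_pos: "0 < measure lborel (cbox a b)"
proof -
  have "measure lebesgue \<Omega> \<le> measure lebesgue (cbox a b)"
    using lmeasurable subset_cbox by (intro measure_mono_fmeasurable) auto
  then show ?thesis using measure_pos by simp
qed

lemma tendsto_grid_fraction_subset:
  assumes "A \<subseteq> \<Omega>" and "negligible (frontier A)"
  shows "(grid_fraction A x \<longlongrightarrow> measure lebesgue A / measure lborel (cbox a b)) multi_at_top"
  using tendsto_grid_fraction[OF grid volume_pos assms(2)] assms(1) subset_cbox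
  by (metis inf.absorb1 order_trans)

lemma filterlim_card_grid_indices:
  "filterlim (\<lambda>n. real (card (grid_indices \<Omega> x n))) at_top multi_at_top"
proof -
  have "filterlim (\<lambda>n. grid_fraction \<Omega> x n * real (card {1..n})) at_top multi_at_top"
    using measure_pos volume_pos
    by (intro filterlim_tendsto_pos_mult_at_top[OF
          tendsto_grid_fraction_subset[OF order_refl negligible_frontier] _
          filterlim_card_atLeastAtMost_one_vec]) simp
  moreover have "grid_fraction \<Omega> x n * real (card {1..n}) \<le> real (card (grid_indices \<Omega> x n))" for n
    by (simp add: grid_fraction_def)
  ultimately show ?thesis by (auto elim!: filterlim_at_top_mono)
qed

lemma eventually_card_open_gt:
  assumes "open V" and "V \<subseteq> \<Omega>" and less: "r < measure lebesgue V / measure lebesgue \<Omega>"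
  shows "eventually (\<lambda>n. r * card (grid_indices \<Omega> x n) < card (grid_indices V x n)) multi_at_top"
proof -
  let ?vol = "measure lborel (cbox a b)"
  have "r * (measure lebesgue \<Omega> / ?vol) < measure lebesgue V / ?vol"
    using less measure_pos volume_pos by (simp add: pos_less_divide_eq divide_strict_right_mono)
  then obtain t where t_greater: "r * (measure lebesgue \<Omega> / ?vol) < t"
      and t_less: "t < measure lebesgue V / ?vol"
    using dense by blast
  have "((\<lambda>n. r * grid_fraction \<Omega> x n) \<longlongrightarrow> r * (measure lebesgue \<Omega> / ?vol)) multi_at_top"
    by (intro tendsto_mult_left tendsto_grid_fraction_subset negligible_frontier order_refl)
  then have "eventually (\<lambda>n. r * grid_fraction \<Omega> x n < t) multi_at_top"
    using t_greater by (rule order_tendstoD(2))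
  moreover have "eventually (\<lambda>n. t < grid_fraction V x n) multi_at_top"
  proof (rule eventually_grid_fraction_open_gt[OF grid \<open>open V\<close>])
    have "V \<inter> cbox a b = V" using \<open>V \<subseteq> \<Omega>\<close> subset_cbox by blast
    then show "t * ?vol < measure lebesgue (V \<inter> cbox a b)"
      using t_less volume_pos by (simp add: pos_less_divide_eq)
  qed
  ultimately show ?thesis
  proof eventually_elim
    case (elim n)
    then have "r * grid_fraction \<Omega> x n < grid_fraction V x n" by linarith
    then have "r * card (grid_indices \<Omega> x n) / card {1..n}
        < card (grid_indices V x n) / card {1..n}"
      by (simp only: grid_fraction_def times_divide_eq_right)
    then show ?case by (meson divide_right_mono not_less of_nat_0_le_iff)
  qed
qed

end

locale spline_sampled_function =
  grid_sampled_domain \<Omega> a b x + continuous_function_on_domain \<Omega> f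
  for \<Omega> :: "(real ^ 'd) set" and a b x f +
  fixes F :: "nat ^ 'd \<Rightarrow> real \<Rightarrow> real"
  assumes spline: "\<And>n. omega \<Omega> x n \<ge> 1 \<Longrightarrow>
    is_linear_spline (omega \<Omega> x n) (sorted_samples \<Omega> f x n) (F n)"
begin

lemma eventually_is_linear_spline:
  "eventually (\<lambda>n. 0 < omega \<Omega> x n \<and> length (sorted_samples \<Omega> f x n) = omega \<Omega> x n + 1 \<and>
    is_linear_spline (omega \<Omega> x n) (sorted_samples \<Omega> f x n) (F n)) multi_at_top"
proof -
  have "eventually (\<lambda>n. 2 \<le> real (card (grid_indices \<Omega> x n))) multi_at_top"
    using filterlim_card_grid_indices unfolding filterlim_at_top by blast
  then show ?thesis
  proof eventually_elim
    case (elim n)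
    then have "1 \<le> omega \<Omega> x n" by (simp add: omega_def)
    with spline elim show ?case by (simp add: length_sorted_samples omega_def)
  qed
qed

lemma eventually_mono_on: "eventually (\<lambda>n. mono_on {0..1} (F n)) multi_at_top"
  using eventually_is_linear_spline
  by eventually_elim (blast intro: is_linear_spline_mono_on sorted_sorted_samples)

lemma eventually_length_filter_samples_ge:
  assumes "law.exceeds y S" and "open S" and "y \<in> {0..1}"
  shows "eventually (\<lambda>n. y * omega \<Omega> x n + 1
    \<le> length (filter (\<lambda>v. v \<in> S) (sorted_samples \<Omega> f x n))) multi_at_top"
  using assms(1) unfolding law.exceeds_def
proof
  assume "y < measure law S"
  then obtain r where "y < r" "r < measure law S" using dense by blast
  let ?V = "{z \<in> interior \<Omega>. f z \<in> S}"
  have "eventually (\<lambda>n. r * card (grid_indices \<Omega> x n) < card (grid_indices ?V x n)) multi_at_top"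
    using \<open>r < measure law S\<close> interior_subset[of \<Omega>]
    by (intro eventually_card_open_gt open_interior_preimage)
       (auto simp: measure_law_open \<open>open S\<close>)
  moreover have "eventually (\<lambda>n. 1 / (r - y) \<le> real (card (grid_indices \<Omega> x n))) multi_at_top"
    using filterlim_card_grid_indices unfolding filterlim_at_top by blast
  ultimately show ?thesis
  proof eventually_elim
    case (elim n)
    have "y * omega \<Omega> x n + 1 \<le> y * card (grid_indices \<Omega> x n) + 1"
      using \<open>y \<in> {0..1}\<close> by (intro add_right_mono mult_left_mono) (auto simp: omega_def)
    also have "\<dots> \<le> r * card (grid_indices \<Omega> x n)" using elim(2) \<open>y < r\<close> by (simp add: field_simps)
    also have "\<dots> \<le> card (grid_indices ?V x n)" using elim(1) by simp
    also have "\<dots> \<le> card (grid_indices {z \<in> \<Omega>. f z \<in> S} x n)"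
      using interior_subset[of \<Omega>] by (intro of_nat_mono card_mono grid_indices_mono) auto
    finally show ?case by (simp add: length_filter_sorted_samples)
  qed
next
  assume "f ` \<Omega> \<subseteq> S"
  then have "{z \<in> \<Omega>. f z \<in> S} = \<Omega>" by auto
  then have "length (filter (\<lambda>v. v \<in> S) (sorted_samples \<Omega> f x n))
      = length (sorted_samples \<Omega> f x n)" for n
    by (simp only: length_filter_sorted_samples length_sorted_samples)
  then show ?thesis
    using eventually_is_linear_spline assms(3)
    by (auto elim!: eventually_mono intro: mult_left_le_one_le)
qed

lemma tendsto_spline:
  assumes y_mem: "y \<in> {0..1}" and "law.quantile_at y q"
  shows "((\<lambda>n. F n y) \<longlongrightarrow> q) multi_at_top"
proof (rule order_tendstoI)
  fix c assume "c < q"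
  then have "law.exceeds (1 - y) {c<..}" using assms(2) by (simp add: law.quantile_at_def)
  then have "eventually (\<lambda>n. (1 - y) * omega \<Omega> x n + 1
      \<le> length (filter (\<lambda>v. v \<in> {c<..}) (sorted_samples \<Omega> f x n))) multi_at_top"
    using y_mem by (intro eventually_length_filter_samples_ge) auto
  with eventually_is_linear_spline show "eventually (\<lambda>n. c < F n y) multi_at_top"
    by eventually_elim (use y_mem in \<open>auto intro: is_linear_spline_greater sorted_sorted_samples\<close>)
next
  fix c assume "q < c"
  then have "law.exceeds y {..<c}" using assms(2) by (simp add: law.quantile_at_def)
  then have "eventually (\<lambda>n. y * omega \<Omega> x n + 1
      \<le> length (filter (\<lambda>v. v \<in> {..<c}) (sorted_samples \<Omega> f x n))) multi_at_top"
    using y_mem by (intro eventually_length_filter_samples_ge) auto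
  with eventually_is_linear_spline show "eventually (\<lambda>n. F n y < c) multi_at_top"
    by eventually_elim (use y_mem in \<open>auto intro: is_linear_spline_less sorted_sorted_samples\<close>)
qed

theorem uniform_limit_monotone_rearrangement:
  assumes "{u..v} \<subseteq> {0..1}"
    and "0 \<in> {u..v} \<Longrightarrow> bdd_below (f ` \<Omega>)" and "1 \<in> {u..v} \<Longrightarrow> bdd_above (f ` \<Omega>)"
  shows "uniform_limit {u..v} F (monotone_rearrangement \<Omega> f) multi_at_top"
proof (rule uniform_limit_mono_on)
  show "eventually (\<lambda>n. mono_on {u..v} (F n)) multi_at_top"
    using eventually_mono_on by eventually_elim (rule mono_on_subset[OF _ assms(1)])
  show "continuous_on {u..v} (monotone_rearrangement \<Omega> f)"
    by (rule continuous_on_monotone_rearrangement[OF assms])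
  show "((\<lambda>n. F n y) \<longlongrightarrow> monotone_rearrangement \<Omega> f y) multi_at_top" if "y \<in> {u..v}" for y
    using that assms by (intro tendsto_spline quantile_at_monotone_rearrangement) auto
qed

end

theorem theorem3p2:
  fixes \<Omega> :: "(real ^ 'd) set"
    and f :: "real ^ 'd \<Rightarrow> real"
    and a b :: "real ^ 'd"
    and x :: "nat ^ 'd \<Rightarrow> nat ^ 'd \<Rightarrow> real ^ 'd"
    and F :: "nat ^ 'd \<Rightarrow> real \<Rightarrow> real"
  assumes "regular_set \<Omega>"
    and "emeasure lebesgue \<Omega> > 0"
    and "connected \<Omega>"
    and "\<Omega> \<subseteq> closure (interior \<Omega>)"
    and "continuous_ae_on \<Omega> f"
    and "a \<le> b"
    and "\<Omega> \<subseteq> cbox a b"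
    and "asymptotically_uniform_grid a b x"
    and "\<And>n. omega \<Omega> x n \<ge> 1 \<Longrightarrow>
           is_linear_spline (omega \<Omega> x n) (sorted_samples \<Omega> f x n) (F n)"
  shows "(continuous_on \<Omega> f \<longrightarrow>
            (\<forall>\<alpha> \<beta>. 0 < \<alpha> \<and> \<alpha> \<le> \<beta> \<and> \<beta> < 1 \<longrightarrow>
               uniform_limit {\<alpha>..\<beta>} F (monotone_rearrangement \<Omega> f) multi_at_top))
       \<and> (continuous_on \<Omega> f \<and> bdd_below (f ` \<Omega>) \<longrightarrow>
            (\<forall>\<alpha>. 0 \<le> \<alpha> \<and> \<alpha> < 1 \<longrightarrow>
               uniform_limit {0..\<alpha>} F (monotone_rearrangement \<Omega> f) multi_at_top))
       \<and> (continuous_on \<Omega> f \<and> bdd_above (f ` \<Omega>) \<longrightarrow>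
            (\<forall>\<alpha>. 0 < \<alpha> \<and> \<alpha> \<le> 1 \<longrightarrow>
               uniform_limit {\<alpha>..1} F (monotone_rearrangement \<Omega> f) multi_at_top))
       \<and> (continuous_on \<Omega> f \<and> bounded (f ` \<Omega>) \<longrightarrow>
            uniform_limit {0..1} F (monotone_rearrangement \<Omega> f) multi_at_top)"
proof -
  have "spline_sampled_function \<Omega> a b x f F" if "continuous_on \<Omega> f"
    by unfold_locales (use assms that in auto)
  note limit = spline_sampled_function.uniform_limit_monotone_rearrangement[OF this]
  show ?thesis
    by (intro conjI impI allI; elim conjE; rule limit)
       (auto intro: bounded_imp_bdd_below bounded_imp_bdd_above)
qed

end
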